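(* Let $L$ be a finite-dimensional solvable Lie algebra over a field $F$. If $F$ has characteristic $p>0$, suppose further that $L^2=[L,L]$ has nilpotency class less than $p$. Let $A/B$ be a chief factor of $L$ that is complemented by a maximal subalgebra $M$ of $L$. If $K$ is conjugate to $M$ in $L$, then there is some $a \in A$ (for which $\exp(\mathrm{ad}\,a)$ is defined) such that $K = \exp(\mathrm{ad}\,a)(M)$ and $M \cap K = \{m \in M : [m,a] \in M\}$.
   Context: A chief factor $A/B$ of $L$ is a quotient of ideals $B\subset A$ of $L$ such that $A/B$ is a minimal (nonzero) ideal of $L/B$, i.e. $A=L_{k+1}$, $B=L_k$ for consecutive terms of a chief series $0=L_0<L_1<\dots<L_n=L$ of $L$. It is complemented by a maximal subalgebra $M$ of $L$ if $B\subseteq M$ and $A\not\subseteq M$; then $L=M+A$ and $M\cap A=B$. For $x\in L$, $\mathrm{ad}\,x$ is the corresponding inner derivation, $y \mapsto [y,x]$. The automorphism $\exp(\mathrm{ad}\,x)=\sum_{r\ge 0}\frac{1}{r!}(\mathrm{ad}\,x)^r$ of $L$ is defined in the following cases: if $F$ has characteristic zero, when $(\mathrm{ad}\,x)^n=0$ for some $n$; if $F$ has characteristic $p>0$, when $x\in I$ for some nilpotent ideal $I$ of $L$ of nilpotency class less than $p$ (then $(\mathrm{ad}\,x)^p=0$ and only the terms with $r<p$ are taken). The group $\mathcal{I}(L)$ of inner automorphisms of $L$ is the group generated by all such automorphisms. Subsets $U,V$ of $L$ are conjugate in $L$ if $U=\alpha(V)$ for some $\alpha\in\mathcal{I}(L)$.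 *)

theory Defs
  imports Complex_Main "HOL-Algebra.Generated_Groups" "HOL-Algebra.Bij"
begin

locale lie_algebra = vector_space scale
  for scale :: "'f::field \<Rightarrow> 'a::ab_group_add \<Rightarrow> 'a" +
  fixes bracket :: "'a \<Rightarrow> 'a \<Rightarrow> 'a"
  assumes bracket_add_left: "bracket (x + y) z = bracket x z + bracket y z"
    and bracket_add_right: "bracket x (y + z) = bracket x y + bracket x z"
    and bracket_scale_left: "bracket (scale c x) y = scale c (bracket x y)"
    and bracket_scale_right: "bracket x (scale c y) = scale c (bracket x y)"
    and bracket_self: "bracket x x = 0"
    and jacobi: "bracket x (bracket y z) + bracket y (bracket z x) + bracket z (bracket x y) = 0"
begin

definition subalgebra :: "'a set \<Rightarrow> bool"
  where "subalgebra S \<longleftrightarrow> subspace S \<and> (\<forall>x\<in>S. \<forall>y\<in>S. bracket x y \<in> S)"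

definition maximal_subalgebra :: "'a set \<Rightarrow> bool"
  where "maximal_subalgebra M \<longleftrightarrow> subalgebra M \<and> M \<noteq> UNIV \<and>
    (\<forall>S. subalgebra S \<and> M \<subseteq> S \<longrightarrow> S = M \<or> S = UNIV)"

definition lie_ideal :: "'a set \<Rightarrow> bool"
  where "lie_ideal I \<longleftrightarrow> subspace I \<and> (\<forall>x\<in>I. \<forall>y. bracket x y \<in> I)"

definition lie_prod :: "'a set \<Rightarrow> 'a set \<Rightarrow> 'a set"
  where "lie_prod U V = span {bracket u v | u v. u \<in> U \<and> v \<in> V}"

primrec derived_series :: "nat \<Rightarrow> 'a set"
  where
    "derived_series 0 = UNIV"
  | "derived_series (Suc n) = lie_prod (derived_series n) (derived_series n)"

definition solvable :: bool
  where "solvable \<longleftrightarrow> (\<exists>n. derived_series n = {0})"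

text \<open>The index is shifted: \<open>lower_central S n\<close> is the term usually written \<open>S\<^sup>n\<^sup>+\<^sup>1\<close>.
  So the zero algebra has nilpotency class 0 and a nonzero abelian algebra has class 1.\<close>

primrec lower_central :: "'a set \<Rightarrow> nat \<Rightarrow> 'a set"
  where
    "lower_central S 0 = S"
  | "lower_central S (Suc n) = lie_prod (lower_central S n) S"

definition nilpotent :: "'a set \<Rightarrow> bool"
  where "nilpotent S \<longleftrightarrow> (\<exists>n. lower_central S n = {0})"

text \<open>Meaningful only for nilpotent subalgebras.\<close>

definition nilpotency_class :: "'a set \<Rightarrow> nat"
  where "nilpotency_class S = (LEAST n. lower_central S n = {0})"

definition coset :: "'a set \<Rightarrow> 'a \<Rightarrow> 'a set"
  where "coset B x = (\<lambda>b. x + b) ` B"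

text \<open>For an ideal \<open>B\<close>, the quotient \<open>L/B\<close> is \<open>range (coset B)\<close> with the operations
  computed on representatives; \<open>quotient_ideal B J\<close> says that \<open>J\<close> is an ideal of \<open>L/B\<close>.\<close>

definition quotient_ideal :: "'a set \<Rightarrow> 'a set set \<Rightarrow> bool"
  where "quotient_ideal B J \<longleftrightarrow>
    J \<subseteq> range (coset B) \<and>
    coset B 0 \<in> J \<and>
    (\<forall>x y. coset B x \<in> J \<and> coset B y \<in> J \<longrightarrow> coset B (x + y) \<in> J) \<and>
    (\<forall>c x. coset B x \<in> J \<longrightarrow> coset B (scale c x) \<in> J) \<and>
    (\<forall>x y. coset B x \<in> J \<longrightarrow> coset B (bracket x y) \<in> J)"

definition minimal_quotient_ideal :: "'a set \<Rightarrow> 'a set set \<Rightarrow> bool"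
  where "minimal_quotient_ideal B J \<longleftrightarrow> quotient_ideal B J \<and> J \<noteq> {coset B 0} \<and>
    (\<forall>J'. quotient_ideal B J' \<and> J' \<subseteq> J \<longrightarrow> J' = {coset B 0} \<or> J' = J)"

definition chief_factor :: "'a set \<Rightarrow> 'a set \<Rightarrow> bool"
  where "chief_factor A B \<longleftrightarrow> lie_ideal A \<and> lie_ideal B \<and> B \<subset> A \<and>
    minimal_quotient_ideal B (coset B ` A)"

definition complements :: "'a set \<Rightarrow> 'a set \<Rightarrow> 'a set \<Rightarrow> bool"
  where "complements M A B \<longleftrightarrow> B \<subseteq> M \<and> \<not> A \<subseteq> M"

definition ad :: "'a \<Rightarrow> 'a \<Rightarrow> 'a"
  where "ad x = (\<lambda>y. bracket y x)"

definition exp_ad_defined :: "'a \<Rightarrow> bool"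
  where "exp_ad_defined x \<longleftrightarrow>
    (if CHAR('f) = 0 then \<exists>n. \<forall>y. (ad x ^^ n) y = 0
     else \<exists>I. lie_ideal I \<and> nilpotent I \<and> nilpotency_class I < CHAR('f) \<and> x \<in> I)"

text \<open>In characteristic zero the series stops at the nilpotency index of \<open>ad x\<close>.
  The value is meaningful only if \<open>exp_ad_defined x\<close>.\<close>

definition exp_ad :: "'a \<Rightarrow> 'a \<Rightarrow> 'a"
  where "exp_ad x y =
    (\<Sum>r < (if CHAR('f) = 0 then (LEAST n. \<forall>z. (ad x ^^ n) z = 0) else CHAR('f)).
      scale (1 / of_nat (fact r)) ((ad x ^^ r) y))"

definition inner_automorphisms :: "('a \<Rightarrow> 'a) set"
  where "inner_automorphisms = generate (BijGroup UNIV) {exp_ad x | x. exp_ad_defined x}"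

definition conjugate :: "'a set \<Rightarrow> 'a set \<Rightarrow> bool"
  where "conjugate U V \<longleftrightarrow> (\<exists>\<alpha>\<in>inner_automorphisms. U = \<alpha> ` V)"

lemma coset_eq_iff:
  assumes "subspace B"
  shows "coset B x = coset B y \<longleftrightarrow> x - y \<in> B"
proof
  assume "coset B x = coset B y"
  moreover have "x \<in> coset B x"
    using subspace_0[OF assms] by (auto simp: coset_def image_iff)
  ultimately obtain b where "b \<in> B" "x = y + b"
    by (auto simp: coset_def)
  then show "x - y \<in> B" by simp
next
  have *: "coset B u \<subseteq> coset B v" if "u - v \<in> B" for u v
  proof
    fix z assume "z \<in> coset B u"
    then obtain b where b: "b \<in> B" "z = u + b" by (auto simp: coset_def)
    then have "z = v + ((u - v) + b)" "(u - v) + b \<in> B"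
      using that subspace_add[OF assms] by simp_all
    then show "z \<in> coset B v" unfolding coset_def by blast
  qed
  assume "x - y \<in> B"
  moreover from this have "y - x \<in> B"
    using subspace_neg[OF assms] by fastforce
  ultimately show "coset B x = coset B y" using * by (simp add: subset_antisym)
qed

lemma coset_mem_image_iff:
  assumes "subspace B" "subspace A" "B \<subseteq> A"
  shows "coset B x \<in> coset B ` A \<longleftrightarrow> x \<in> A"
proof
  assume "coset B x \<in> coset B ` A"
  then obtain a where "a \<in> A" "x - a \<in> B"
    using coset_eq_iff[OF assms(1)] by auto
  then have "a + (x - a) \<in> A" using assms subspace_add by blast
  then show "x \<in> A" by simp
qed simp

lemma quotient_ideal_image:
  assumes "lie_ideal B" "lie_ideal C" "B \<subseteq> C"
  shows "quotient_ideal B (coset B ` C)"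
proof -
  have s: "subspace B" "subspace C" using assms by (auto simp: lie_ideal_def)
  show ?thesis
    using assms(2) subspace_0[OF s(2)] subspace_add[OF s(2)] subspace_scale[OF s(2)]
    unfolding quotient_ideal_def coset_mem_image_iff[OF s assms(3)]
    by (auto simp: lie_ideal_def)
qed

lemma chief_factor_iff:
  "chief_factor A B \<longleftrightarrow> lie_ideal A \<and> lie_ideal B \<and> B \<subset> A \<and>
    (\<forall>C. lie_ideal C \<and> B \<subseteq> C \<and> C \<subseteq> A \<longrightarrow> C = B \<or> C = A)"
proof (cases "lie_ideal A \<and> lie_ideal B \<and> B \<subset> A")
  case True
  then have A: "lie_ideal A" and B: "lie_ideal B" and BA: "B \<subset> A" by auto
  have sA: "subspace A" and sB: "subspace B" using A B by (auto simp: lie_ideal_def)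
  have zero: "coset B ` B = {coset B 0}"
  proof -
    have "coset B b = coset B 0" if "b \<in> B" for b
      using that coset_eq_iff[OF sB, of b 0] by simp
    then show ?thesis using subspace_0[OF sB] by blast
  qed
  have inj: "C = D" if "lie_ideal C" "lie_ideal D" "B \<subseteq> C" "B \<subseteq> D" "coset B ` C = coset B ` D" for C D
  proof -
    have "subspace C" "subspace D" using that by (auto simp: lie_ideal_def)
    then have "x \<in> C \<longleftrightarrow> x \<in> D" for x
      using coset_mem_image_iff[OF sB _ that(3), of x] coset_mem_image_iff[OF sB _ that(4), of x]
        that(5) by simp
    then show ?thesis by blast
  qed
  have pre: "\<exists>C. lie_ideal C \<and> B \<subseteq> C \<and> J = coset B ` C" if J: "quotient_ideal B J" for J
  proof (intro exI conjI)
    let ?C = "{x. coset B x \<in> J}"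
    show "lie_ideal ?C"
      unfolding lie_ideal_def subspace_def
      using J[unfolded quotient_ideal_def] by simp
    have "coset B 0 \<in> J" "J \<subseteq> range (coset B)"
      using J[unfolded quotient_ideal_def] by simp_all
    moreover have "coset B b = coset B 0" if "b \<in> B" for b
      using zero that by blast
    ultimately show "B \<subseteq> ?C" "J = coset B ` ?C"
      by (simp add: subset_iff, blast)
  qed
  have sub: "C \<subseteq> A" if "lie_ideal C" "coset B ` C \<subseteq> coset B ` A" for C
  proof
    fix x assume "x \<in> C"
    then have "coset B x \<in> coset B ` A" using that by blast
    then show "x \<in> A" using coset_mem_image_iff[OF sB sA, of x] BA by simp
  qed
  have qA: "quotient_ideal B (coset B ` A)" "coset B ` A \<noteq> {coset B 0}"
  proof -
    show "quotient_ideal B (coset B ` A)" using quotient_ideal_image[OF B A] BA by simp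
    show "coset B ` A \<noteq> {coset B 0}"
    proof
      assume "coset B ` A = {coset B 0}"
      then have "coset B ` A = coset B ` B" by (simp only: zero)
      then show False using inj[OF A B] BA by (simp add: psubset_eq)
    qed
  qed
  show ?thesis
  proof
    assume "chief_factor A B"
    then have m: "\<And>J. quotient_ideal B J \<Longrightarrow> J \<subseteq> coset B ` A \<Longrightarrow> J = coset B ` B \<or> J = coset B ` A"
      unfolding zero chief_factor_def minimal_quotient_ideal_def by blast
    have "C = B \<or> C = A" if C: "lie_ideal C" "B \<subseteq> C" "C \<subseteq> A" for C
    proof -
      have "coset B ` C \<subseteq> coset B ` A" using C(3) by (rule image_mono)
      with m[OF quotient_ideal_image[OF B C(1,2)]]
      have "coset B ` C = coset B ` B \<or> coset B ` C = coset B ` A" .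
      then show ?thesis
        using inj[OF C(1) B C(2)] inj[OF C(1) A C(2)] BA by (meson order_refl psubset_imp_subset)
    qed
    then show "lie_ideal A \<and> lie_ideal B \<and> B \<subset> A \<and>
      (\<forall>C. lie_ideal C \<and> B \<subseteq> C \<and> C \<subseteq> A \<longrightarrow> C = B \<or> C = A)" using True by blast
  next
    assume r: "lie_ideal A \<and> lie_ideal B \<and> B \<subset> A \<and>
      (\<forall>C. lie_ideal C \<and> B \<subseteq> C \<and> C \<subseteq> A \<longrightarrow> C = B \<or> C = A)"
    have "J = {coset B 0} \<or> J = coset B ` A"
      if J: "quotient_ideal B J" "J \<subseteq> coset B ` A" for J
    proof -
      obtain C where C: "lie_ideal C" "B \<subseteq> C" "J = coset B ` C" using pre[OF J(1)] by blast
      then have "C \<subseteq> A" using sub J(2) by simp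
      then have "C = B \<or> C = A" using r C by simp
      then show ?thesis using C(3) zero by auto
    qed
    then show "chief_factor A B"
      using A B BA qA by (simp add: chief_factor_def minimal_quotient_ideal_def)
  qed
qed (auto simp: chief_factor_def)

end

end

theory Submission
  imports Defs "HOL-Computational_Algebra.Polynomial"
begin

text \<open>
  Write \<open>C\<close> for the centralizer of \<open>A/B\<close>, that is, the set of all \<open>x\<close> with \<open>[A, x] \<subseteq> B\<close>.  The
  whole argument rests on two facts: every \<open>x\<close> for which \<open>exp (ad x)\<close> is defined lies in \<open>C\<close>, and
  modulo the ideal \<open>D = C \<inter> M\<close> such an \<open>x\<close> acts on \<open>L\<close> like some \<open>n \<in> A \<inter> L\<^sup>2\<close>.

  The first fact follows from \<open>L\<^sup>2 \<subseteq> C\<close> (\<open>derived_algebra_acts_trivially\<close>).  For solvable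
  \<open>L\<close> in characteristic zero this is a form of Lie's theorem; the proof here works over an
  arbitrary field of characteristic zero, without eigenvalues, by descending along the derived
  series.  It uses Jacobson's lemma that a commutator \<open>[X, Y]\<close> of operators that commutes with \<open>Y\<close>
  is nilpotent, together with the observation that a set of commuting nilpotent operators that is
  closed under brackets with \<open>L\<close> has to vanish on a chief factor
  (\<open>nilpotent_family_acts_trivially\<close>).  In positive characteristic \<open>L\<^sup>2\<close> is a nilpotent ideal by
  assumption, so its elements are ad-nilpotent and take over the part of Jacobson's lemma.  Once
  \<open>L\<^sup>2 \<subseteq> C\<close> is known, the same observation, applied to the single operator \<open>ad x\<close>, puts every
  ad-nilpotent \<open>x\<close> into \<open>C\<close>.

  The second fact follows from \<open>L = M + A\<close>: since \<open>A \<subseteq> C\<close>, one has \<open>C = D + A\<close>, and the \<open>A\<close>-part of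
  \<open>x\<close> may be moved into \<open>L\<^sup>2\<close> modulo \<open>B \<subseteq> D\<close> unless \<open>A/B\<close> is central, in which case \<open>n = 0\<close>
  works.

  Because \<open>A/B\<close> is abelian, all terms of \<open>exp (ad x)\<close> of degree at least two fall into \<open>D\<close>, so
  \<open>exp (ad x) l\<close> is \<open>l + [l, n]\<close> modulo \<open>D\<close>.  Therefore \<open>exp (ad x)\<close> carries the set
  \<open>{l. l - [l, n'] \<in> M}\<close> onto \<open>{l. l - [l, n' + n] \<in> M}\<close>, for every \<open>n' \<in> A\<close>.  Products and inverses
  of such maps only add and negate the parameters, so that every conjugate of \<open>M\<close> is
  \<open>{l. l - [l, a] \<in> M}\<close> for some \<open>a \<in> A \<inter> L\<^sup>2\<close>.  For \<open>a \<in> L\<^sup>2\<close> the map \<open>exp (ad a)\<close> is defined: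
  in characteristic zero \<open>ad a\<close> is nilpotent because \<open>a\<close> acts trivially on every chief factor, and in
  positive characteristic \<open>L\<^sup>2\<close> itself is an ideal of small class.  This map carries \<open>M\<close> to the same
  set, so it yields the given conjugate.  The intersection formula can be read off from this description.
\<close>

section \<open>Polynomials in a linear operator\<close>

text \<open>
  The operator \<open>p(f)\<close>, evaluated by Horner's scheme in the same way as \<^const>\<open>poly\<close>.
\<close>

definition poly_op :: "('f::field \<Rightarrow> 'a::ab_group_add \<Rightarrow> 'a) \<Rightarrow> ('a \<Rightarrow> 'a) \<Rightarrow> 'f poly \<Rightarrow> 'a \<Rightarrow> 'a"
  where "poly_op scale f p v = fold_coeffs (\<lambda>c w. scale c v + f w) p 0"

lemma funpow_invariant: "(\<And>v. v \<in> U \<Longrightarrow> f v \<in> U) \<Longrightarrow> v \<in> U \<Longrightarrow> (f ^^ n) v \<in> U"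
  by (induction n) simp_all

context vector_space
begin

lemma poly_op_0 [simp]: "poly_op scale f 0 v = 0"
  by (simp add: poly_op_def)

lemma poly_op_pCons:
  assumes "module_hom scale scale f"
  shows "poly_op scale f (pCons c p) v = scale c v + f (poly_op scale f p v)"
proof (cases "pCons c p = 0")
  case True
  then show ?thesis by (simp add: module_hom.zero[OF assms])
next
  case False
  then show ?thesis
    by (cases "p = 0") (simp_all add: poly_op_def module_hom.zero[OF assms])
qed

lemma poly_op_add:
  assumes "module_hom scale scale f"
  shows "poly_op scale f (p + q) v = poly_op scale f p v + poly_op scale f q v"
  by (induction p q rule: poly_induct2)
    (simp_all add: poly_op_pCons[OF assms] module_hom.add[OF assms] scale_left_distrib)

lemma poly_op_smult:
  assumes "module_hom scale scale f"
  shows "poly_op scale f (smult c p) v = scale c (poly_op scale f p v)"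
  by (induction p)
    (simp_all add: poly_op_pCons[OF assms] module_hom.scale[OF assms] scale_right_distrib)

lemma poly_op_mult:
  assumes "module_hom scale scale f"
  shows "poly_op scale f (p * q) v = poly_op scale f p (poly_op scale f q v)"
  by (induction p)
    (simp_all add: poly_op_pCons[OF assms] poly_op_add[OF assms] poly_op_smult[OF assms])

lemma poly_op_sum:
  assumes "module_hom scale scale f"
  shows "poly_op scale f (\<Sum>i\<in>I. p i) v = (\<Sum>i\<in>I. poly_op scale f (p i) v)"
  by (induction I rule: infinite_finite_induct) (simp_all add: poly_op_add[OF assms])

lemma poly_op_monom:
  assumes "module_hom scale scale f"
  shows "poly_op scale f (monom c n) v = scale c ((f ^^ n) v)"
  by (induction n)
    (simp_all add: monom_0 monom_Suc poly_op_pCons[OF assms] module_hom.scale[OF assms]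
      module_hom.zero[OF assms])

lemma module_hom_poly_op:
  assumes f: "module_hom scale scale f"
  shows "module_hom scale scale (poly_op scale f p)"
proof (induction p)
  case 0
  show ?case by (simp add: module_hom_iff module_axioms)
next
  case (pCons c p)
  then show ?case
    by (simp add: module_hom_iff poly_op_pCons[OF f] module_hom.add[OF f] module_hom.scale[OF f]
        scale_right_distrib scale_left_commute)
qed

lemma poly_op_invariant:
  assumes "module_hom scale scale f" "subspace U" "\<And>v. v \<in> U \<Longrightarrow> f v \<in> U" "v \<in> U"
  shows "poly_op scale f p v \<in> U"
  by (induction p) (simp_all add: assms poly_op_pCons subspace_0 subspace_add subspace_scale)

lemma module_hom_funpow:
  assumes "module_hom scale scale f"
  shows "module_hom scale scale (f ^^ n)"
proof (induction n)
  case 0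
  show ?case by (simp add: module_hom_iff module_axioms)
next
  case (Suc n)
  show ?case using module_hom_compose[OF Suc assms] by (simp add: o_def)
qed

text \<open>
  If \<open>[X, Y] = Z\<close> commutes with \<open>Y\<close>, then \<open>p \<mapsto> [X, p(Y)]\<close> is a derivation on the polynomials in \<open>Y\<close>
  that maps \<open>Y\<close> to \<open>Z\<close>, whence \<open>[X, p(Y)] = p'(Y) Z\<close>.  The operators live on \<open>A\<close> and the commutation
  of \<open>Z\<close> and \<open>Y\<close> is only required modulo \<open>B\<close>, which expresses the situation on the quotient \<open>A/B\<close>
  by means of representatives.
\<close>

lemma poly_op_commutator:
  assumes X: "module_hom scale scale X" and Y: "module_hom scale scale Y"
    and Z: "module_hom scale scale Z"
    and A: "subspace A" "\<And>v. v \<in> A \<Longrightarrow> Y v \<in> A"  "\<And>v. v \<in> A \<Longrightarrow> Z v \<in> A"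
    and B: "subspace B" "\<And>v. v \<in> B \<Longrightarrow> Y v \<in> B"
    and XY: "\<And>v. v \<in> A \<Longrightarrow> X (Y v) = Y (X v) + Z v"
    and ZY: "\<And>v. v \<in> A \<Longrightarrow> Z (Y v) - Y (Z v) \<in> B"
    and v: "v \<in> A"
  shows "Z (poly_op scale Y p v) - poly_op scale Y p (Z v) \<in> B" (is ?comm)
    and "X (poly_op scale Y p v) - poly_op scale Y p (X v) - poly_op scale Y (pderiv p) (Z v) \<in> B" (is ?deriv)
proof -
  have comm: "Z (poly_op scale Y p v) - poly_op scale Y p (Z v) \<in> B" for p
  proof (induction p)
    case 0
    show ?case using B(1) by (simp add: module_hom.zero[OF Z] subspace_0)
  next
    case (pCons c p)
    define w where "w = poly_op scale Y p v"
    have "w \<in> A" unfolding w_def by (rule poly_op_invariant[OF Y A(1,2) v])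
    then have "Z (Y w) - Y (Z w) \<in> B" by (rule ZY)
    moreover have "Y (Z w - poly_op scale Y p (Z v)) \<in> B" using B(2) pCons by (simp add: w_def)
    ultimately have "(Z (Y w) - Y (Z w)) + Y (Z w - poly_op scale Y p (Z v)) \<in> B"
      using B(1) subspace_add by blast
    then show ?case
      by (simp add: poly_op_pCons[OF Y] module_hom.add[OF Z] module_hom.scale[OF Z]
          module_hom.diff[OF Y] w_def)
  qed
  show ?comm by (rule comm)
  show ?deriv
  proof (induction p)
    case 0
    show ?case using B(1) by (simp add: module_hom.zero[OF X] subspace_0)
  next
    case (pCons c p)
    define w where "w = poly_op scale Y p v"
    define w' where "w' = poly_op scale Y (pderiv p) (Z v)"
    have "w \<in> A" unfolding w_def by (rule poly_op_invariant[OF Y A(1,2) v])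
    then have XYw: "X (Y w) = Y (X w) + Z w" by (rule XY)
    have "Y (X w - poly_op scale Y p (X v) - w') \<in> B" using B(2) pCons by (simp add: w_def w'_def)
    moreover have "Z w - poly_op scale Y p (Z v) \<in> B" using comm by (simp add: w_def)
    ultimately have "Y (X w - poly_op scale Y p (X v) - w') + (Z w - poly_op scale Y p (Z v)) \<in> B"
      using B(1) subspace_add by blast
    moreover have "X (poly_op scale Y (pCons c p) v) - poly_op scale Y (pCons c p) (X v)
        - poly_op scale Y (pderiv (pCons c p)) (Z v)
      = Y (X w - poly_op scale Y p (X v) - w') + (Z w - poly_op scale Y p (Z v))"
      by (simp add: poly_op_pCons[OF Y] poly_op_add[OF Y] pderiv_pCons
          module_hom.add[OF X] module_hom.scale[OF X] module_hom.diff[OF Y] XYw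
          flip: w_def w'_def)
    ultimately show ?case by simp
  qed
qed

text \<open>
  Taking the commutator with \<open>X\<close> turns \<open>p(Y) Z\<^sup>e = 0\<close> into \<open>p'(Y) Z\<^sup>e\<^sup>+\<^sup>1 = - p(Y) X Z\<^sup>e\<close>, and
  multiplying by \<open>Z\<^sup>e\<close> from the left kills the right-hand side, because \<open>Z\<^sup>e p(Y) = p(Y) Z\<^sup>e = 0\<close>.
  So \<open>p'(Y) Z\<^sup>2\<^sup>e\<^sup>+\<^sup>1 = 0\<close>.  In characteristic zero repeated differentiation reaches a nonzero constant,
  and then a power of \<open>Z\<close> vanishes.
\<close>

lemma nilpotent_of_annihilator:
  assumes char0: "CHAR('a) = 0"
    and X: "module_hom scale scale X" and Y: "module_hom scale scale Y"
    and Z: "module_hom scale scale Z"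
    and A: "subspace A" "\<And>v. v \<in> A \<Longrightarrow> X v \<in> A" "\<And>v. v \<in> A \<Longrightarrow> Y v \<in> A"
      "\<And>v. v \<in> A \<Longrightarrow> Z v \<in> A"
    and B: "subspace B" "\<And>v. v \<in> B \<Longrightarrow> X v \<in> B" "\<And>v. v \<in> B \<Longrightarrow> Y v \<in> B"
      "\<And>v. v \<in> B \<Longrightarrow> Z v \<in> B"
    and XY: "\<And>v. v \<in> A \<Longrightarrow> X (Y v) = Y (X v) + Z v"
    and ZY: "\<And>v. v \<in> A \<Longrightarrow> Z (Y v) - Y (Z v) \<in> B"
    and "p \<noteq> 0" "\<And>v. v \<in> A \<Longrightarrow> poly_op scale Y p ((Z ^^ e) v) \<in> B"
  shows "\<exists>N. \<forall>v\<in>A. (Z ^^ N) v \<in> B"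
  using assms(15-)
proof (induction "degree p" arbitrary: p e)
  case 0
  then obtain c where c: "p = [:c:]" "c \<noteq> 0" by (metis degree_eq_zeroE pCons_0_0)
  have "(Z ^^ e) v \<in> B" if "v \<in> A" for v
  proof -
    have "scale c ((Z ^^ e) v) \<in> B"
      using 0(3)[OF that] by (simp add: c poly_op_pCons[OF Y] module_hom.zero[OF Y])
    then have "scale (inverse c) (scale c ((Z ^^ e) v)) \<in> B" by (rule subspace_scale[OF B(1)])
    then show ?thesis using c(2) by simp
  qed
  then show ?case by blast
next
  case (Suc n)
  have comm_1: "Z (poly_op scale Y q v) - poly_op scale Y q (Z v) \<in> B"
    and comm_2: "X (poly_op scale Y q v) - poly_op scale Y q (X v)
      - poly_op scale Y (pderiv q) (Z v) \<in> B" if "v \<in> A" for q v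
    using poly_op_commutator[OF X Y Z, of A B v q] A B XY ZY that by auto
  have hom_Z: "module_hom scale scale (Z ^^ k)" for k by (rule module_hom_funpow[OF Z])
  have Z_A: "(Z ^^ k) v \<in> A" if "v \<in> A" for v k by (rule funpow_invariant) (use A that in auto)
  have Z_B: "(Z ^^ k) v \<in> B" if "v \<in> B" for v k by (rule funpow_invariant) (use B that in auto)
  have comm_pow: "(Z ^^ k) (poly_op scale Y q v) - poly_op scale Y q ((Z ^^ k) v) \<in> B" if "v \<in> A" for q k v
  proof (induction k)
    case 0
    show ?case using B(1) by (simp add: subspace_0)
  next
    case (Suc k)
    have "Z ((Z ^^ k) (poly_op scale Y q v) - poly_op scale Y q ((Z ^^ k) v))
        + (Z (poly_op scale Y q ((Z ^^ k) v)) - poly_op scale Y q (Z ((Z ^^ k) v))) \<in> B"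
      using Suc comm_1[OF Z_A[OF that]] B(1,4) by (intro subspace_add) auto
    then show ?case by (simp add: module_hom.diff[OF Z])
  qed
  have coeff: "coeff (pderiv p) n = of_nat (Suc n) * lead_coeff p"
    by (simp only: coeff_pderiv Suc(2)[symmetric])
  have nz: "coeff (pderiv p) n \<noteq> 0"
    using Suc(3) char0 of_nat_eq_0_iff_char_dvd[where 'a='a, of "Suc n"]
    unfolding coeff by (simp del: of_nat_Suc)
  have "degree (pderiv p) \<le> n"
    by (rule degree_le) (simp add: coeff_pderiv coeff_eq_0 flip: Suc(2))
  then have deg: "n = degree (pderiv p)" using le_degree[OF nz] by simp
  show ?case
  proof (rule Suc(1)[OF deg])
    show "pderiv p \<noteq> 0" using nz by auto
    fix v assume v: "v \<in> A"
    let ?u = "(Z ^^ e) v"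
    have uA: "?u \<in> A" by (rule Z_A[OF v])
    then have XuA: "X ?u \<in> A" by (rule A)
    have 1: "X (poly_op scale Y p ?u) \<in> B" by (rule B(2), rule Suc(4)[OF v])
    have 2: "X (poly_op scale Y p ?u) - poly_op scale Y p (X ?u) - poly_op scale Y (pderiv p) (Z ?u) \<in> B"
      by (rule comm_2[OF uA])
    have "poly_op scale Y (pderiv p) (Z ?u) + poly_op scale Y p (X ?u) \<in> B"
      using subspace_diff[OF B(1) 1 2] by (simp add: algebra_simps)
    then have "(Z ^^ e) (poly_op scale Y (pderiv p) (Z ?u)) + (Z ^^ e) (poly_op scale Y p (X ?u)) \<in> B"
      using Z_B by (simp flip: module_hom.add[OF hom_Z])
    moreover have "(Z ^^ e) (poly_op scale Y p (X ?u)) \<in> B"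
      using subspace_add[OF B(1) comm_pow[OF XuA, of e p] Suc(4)[OF XuA]] by simp
    ultimately have "(Z ^^ e) (poly_op scale Y (pderiv p) (Z ?u)) \<in> B"
      using subspace_diff[OF B(1)] by fastforce
    then have "poly_op scale Y (pderiv p) ((Z ^^ e) (Z ?u)) \<in> B"
      using subspace_diff[OF B(1) _ comm_pow[OF A(4)[OF uA], of e "pderiv p"]] by fastforce
    then show "poly_op scale Y (pderiv p) ((Z ^^ (e + Suc e)) v) \<in> B"
      by (simp add: funpow_add funpow_swap1)
  qed
qed

end

context finite_dimensional_vector_space
begin

text \<open>
  Among the \<open>dimension + 1\<close> vectors \<open>f\<^sup>i v\<close> with \<open>i \<le> dimension\<close> there is a linear relation, either
  because two of them coincide or because there are too many of them.
\<close>

lemma vector_annihilated: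
  assumes f: "module_hom scale scale f"
  shows "\<exists>p. p \<noteq> 0 \<and> poly_op scale f p v = 0"
proof (cases "inj_on (\<lambda>i. (f ^^ i) v) {..dimension}")
  case False
  then obtain i j where ij: "i \<noteq> j" "(f ^^ i) v = (f ^^ j) v" by (auto simp: inj_on_def)
  let ?p = "monom 1 i + monom (-1) j :: 'a poly"
  have "coeff ?p i = 1" using ij(1) by simp
  then have "?p \<noteq> 0" by (metis coeff_0 zero_neq_one)
  moreover have "poly_op scale f ?p v = 0"
    using ij(2) by (simp add: poly_op_add[OF f] poly_op_monom[OF f])
  ultimately show ?thesis by blast
next
  case inj: True
  let ?g = "\<lambda>i. (f ^^ i) v"
  let ?S = "?g ` {..dimension}"
  have "card ?S = Suc dimension" using card_image[OF inj] by simp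
  then have "dim ?S < card ?S" using dim_subset_UNIV[of ?S] by simp
  then have "dependent ?S" using dependent_biggerset_general[of ?S] by simp
  then obtain u where u: "\<exists>w\<in>?S. u w \<noteq> 0" "(\<Sum>w\<in>?S. scale (u w) w) = 0"
    using dependent_finite[of ?S] by auto
  then obtain i where i: "i \<le> dimension" "u (?g i) \<noteq> 0" by auto
  let ?p = "\<Sum>j\<le>dimension. monom (u (?g j)) j"
  have "coeff ?p i = u (?g i)" using i(1) by (simp add: coeff_sum sum.delta)
  then have "?p \<noteq> 0" using i(2) by auto
  moreover have "poly_op scale f ?p v = 0"
    using u(2) by (simp add: poly_op_sum[OF f] poly_op_monom[OF f] sum.reindex[OF inj])
  ultimately show ?thesis by blast
qed

text \<open>
  Multiplying annihilators of the basis vectors together gives an annihilator of the operator.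
\<close>

lemma operator_annihilated:
  assumes f: "module_hom scale scale f"
  shows "\<exists>p. p \<noteq> 0 \<and> (\<forall>v. poly_op scale f p v = 0)"
proof -
  have "\<exists>p. p \<noteq> 0 \<and> (\<forall>v\<in>S. poly_op scale f p v = 0)" if "finite S" for S
    using that
  proof (induction S)
    case empty
    show ?case by (rule exI[of _ 1]) simp
  next
    case (insert w S)
    then obtain p where p: "p \<noteq> 0" "\<And>v. v \<in> S \<Longrightarrow> poly_op scale f p v = 0" by blast
    obtain q where q: "q \<noteq> 0" "poly_op scale f q (poly_op scale f p w) = 0"
      using vector_annihilated[OF f] by blast
    have "poly_op scale f (q * p) v = 0" if "v \<in> insert w S" for v
      using that p(2) q(2) module_hom.zero[OF module_hom_poly_op[OF f]]
      by (auto simp: poly_op_mult[OF f])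
    then show ?case using p(1) q(1) by (intro exI[of _ "q * p"]) simp
  qed
  from this[OF finite_Basis] obtain p
    where p: "p \<noteq> 0" "\<And>v. v \<in> Basis \<Longrightarrow> poly_op scale f p v = 0" by blast
  have "poly_op scale f p v = 0" for v
  proof -
    have "subspace {v. poly_op scale f p v = 0}"
      using module_hom_poly_op[OF f, of p] by (simp add: subspace_def module_hom.add module_hom.scale module_hom.zero)
    then have "span Basis \<subseteq> {v. poly_op scale f p v = 0}" using p(2) by (intro span_minimal) auto
    then show ?thesis using span_Basis by auto
  qed
  then show ?thesis using p(1) by blast
qed

text \<open>
  Jacobson's lemma for the quotient \<open>A/B\<close>.  In finite dimension some nonzero polynomial in \<open>Y\<close>
  vanishes, which starts the descent along derivatives with the exponent \<open>e = 0\<close>.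
\<close>

lemma commutator_nilpotent:
  assumes char0: "CHAR('a) = 0"
    and X: "module_hom scale scale X" and Y: "module_hom scale scale Y"
    and Z: "module_hom scale scale Z"
    and A: "subspace A" "\<And>v. v \<in> A \<Longrightarrow> X v \<in> A" "\<And>v. v \<in> A \<Longrightarrow> Y v \<in> A"
      "\<And>v. v \<in> A \<Longrightarrow> Z v \<in> A"
    and B: "subspace B" "\<And>v. v \<in> B \<Longrightarrow> X v \<in> B" "\<And>v. v \<in> B \<Longrightarrow> Y v \<in> B"
      "\<And>v. v \<in> B \<Longrightarrow> Z v \<in> B"
    and XY: "\<And>v. v \<in> A \<Longrightarrow> X (Y v) = Y (X v) + Z v"
    and ZY: "\<And>v. v \<in> A \<Longrightarrow> Z (Y v) - Y (Z v) \<in> B"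
  shows "\<exists>N. \<forall>v\<in>A. (Z ^^ N) v \<in> B"
proof -
  obtain p where p: "p \<noteq> 0" "\<And>v. poly_op scale Y p v = 0" using operator_annihilated[OF Y] by blast
  have "poly_op scale Y p ((Z ^^ 0) v) \<in> B" for v using p(2) subspace_0[OF B(1)] by simp
  with nilpotent_of_annihilator[OF assms p(1)] show ?thesis by blast
qed

end

section \<open>Brackets and ideals\<close>

context lie_algebra
begin

lemma bracket_0_left [simp]: "bracket 0 y = 0"
  using bracket_add_left[of 0 0 y] by simp

lemma bracket_0_right [simp]: "bracket y 0 = 0"
  using bracket_add_right[of y 0 0] by simp

lemma bracket_minus_left: "bracket (- x) y = - bracket x y"
  using bracket_add_left[of "- x" x y] by (simp add: eq_neg_iff_add_eq_0)

lemma bracket_minus_right: "bracket x (- y) = - bracket x y"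
  using bracket_add_right[of x "- y" y] by (simp add: eq_neg_iff_add_eq_0)

lemma bracket_diff_left: "bracket (x - y) z = bracket x z - bracket y z"
  using bracket_add_left[of x "- y" z] by (simp add: bracket_minus_left)

lemma bracket_diff_right: "bracket x (y - z) = bracket x y - bracket x z"
  using bracket_add_right[of x y "- z"] by (simp add: bracket_minus_right)

lemma bracket_skew: "bracket x y = - bracket y x"
proof -
  have "bracket (x + y) (x + y) = bracket x y + bracket y x"
    by (simp only: bracket_add_left bracket_add_right) (simp add: bracket_self)
  then show ?thesis by (simp add: bracket_self eq_neg_iff_add_eq_0)
qed

text \<open>
  The Jacobi identity in the form in which it is used throughout: \<open>ad\<close> acts by brackets from the
  right, and \<open>[ad y, ad x] = ad [x, y]\<close>.
\<close>

lemma bracket_bracket_left: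
  "bracket (bracket v x) y = bracket (bracket v y) x + bracket v (bracket x y)"
  using jacobi[of v x y] bracket_skew[of y "bracket v x"] bracket_skew[of x "bracket y v"]
    bracket_skew[of y v] by (simp add: bracket_minus_left add.commute)

lemma module_hom_ad: "module_hom scale scale (ad x)"
  by (simp add: module_hom_iff module_axioms ad_def bracket_add_left bracket_scale_left)

lemma lie_idealD:
  assumes "lie_ideal I"
  shows "subspace I" "x \<in> I \<Longrightarrow> bracket x y \<in> I" "x \<in> I \<Longrightarrow> bracket y x \<in> I"
proof -
  show s: "subspace I" and r: "x \<in> I \<Longrightarrow> bracket x y \<in> I"
    using assms by (auto simp: lie_ideal_def)
  show "x \<in> I \<Longrightarrow> bracket y x \<in> I"
    using assms subspace_neg[OF s] bracket_skew[of y x] by (auto simp: lie_ideal_def)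
qed

lemma lie_ideal_UNIV: "lie_ideal UNIV"
  by (simp add: lie_ideal_def)

lemma lie_prod_base: "u \<in> U \<Longrightarrow> v \<in> V \<Longrightarrow> bracket u v \<in> lie_prod U V"
  unfolding lie_prod_def by (rule span_base) blast

lemma lie_prod_induct:
  assumes "subspace W" "\<And>u v. u \<in> U \<Longrightarrow> v \<in> V \<Longrightarrow> bracket u v \<in> W"
  shows "lie_prod U V \<subseteq> W"
  unfolding lie_prod_def using assms by (intro span_minimal) auto

lemma lie_ideal_lie_prod:
  assumes U: "lie_ideal U" and V: "lie_ideal V"
  shows "lie_ideal (lie_prod U V)"
proof -
  have "subspace {z. \<forall>l. bracket z l \<in> lie_prod U V}"
    unfolding subspace_def lie_prod_def
    by (simp add: span_zero span_add span_scale bracket_add_left bracket_scale_left)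
  then have "lie_prod U V \<subseteq> {z. \<forall>l. bracket z l \<in> lie_prod U V}"
  proof (rule lie_prod_induct, safe)
    fix u v l assume uv: "u \<in> U" "v \<in> V"
    then have "bracket (bracket u l) v + bracket u (bracket v l) \<in> lie_prod U V"
      using lie_prod_base lie_idealD(2)[OF U] lie_idealD(2)[OF V]
      by (simp add: lie_prod_def span_add)
    then show "bracket (bracket u v) l \<in> lie_prod U V"
      by (simp add: bracket_bracket_left[of u v l])
  qed
  then show ?thesis by (auto simp: lie_ideal_def lie_prod_def)
qed

lemma lie_ideal_derived_series: "lie_ideal (derived_series n)"
  by (induction n) (simp_all add: lie_ideal_UNIV lie_ideal_lie_prod)

lemma derived_series_Suc_subset: "derived_series (Suc n) \<subseteq> derived_series n"
  using lie_prod_induct lie_idealD[OF lie_ideal_derived_series] by simp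

lemma derived_series_subset: "1 \<le> n \<Longrightarrow> derived_series n \<subseteq> lie_prod UNIV UNIV"
  by (induction n rule: dec_induct) (use derived_series_Suc_subset in auto)

definition factor_centralizer :: "'a set \<Rightarrow> 'a set \<Rightarrow> 'a set"
  where "factor_centralizer A B = {x. \<forall>v\<in>A. bracket v x \<in> B}"

lemma lie_ideal_factor_centralizer:
  assumes A: "lie_ideal A" and B: "lie_ideal B"
  shows "lie_ideal (factor_centralizer A B)"
proof -
  note sB = lie_idealD(1)[OF B]
  have "bracket v (bracket x l) \<in> B" if "x \<in> factor_centralizer A B" "v \<in> A" for x l v
  proof -
    have "bracket (bracket v x) l - bracket (bracket v l) x \<in> B"
      using that lie_idealD(2)[OF A] lie_idealD(2)[OF B]
      by (intro subspace_diff[OF sB]) (auto simp: factor_centralizer_def)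
    then show ?thesis by (simp add: bracket_bracket_left[of v x l])
  qed
  then show ?thesis
    unfolding lie_ideal_def
    by (auto simp: factor_centralizer_def subspace_def bracket_add_right bracket_scale_right
        subspace_0[OF sB] subspace_add[OF sB] subspace_scale[OF sB])
qed

lemma chief_factor_dichotomy:
  assumes "chief_factor A B" "lie_ideal C" "B \<subseteq> C" "C \<subseteq> A" "x \<in> C" "x \<notin> B"
  shows "C = A"
  using assms unfolding chief_factor_iff by blast

lemma chief_factorD:
  assumes "chief_factor A B"
  shows "lie_ideal A" "lie_ideal B" "B \<subseteq> A" "B \<noteq> A"
  using assms by (auto simp: chief_factor_def)

end

locale fd_lie_algebra = lie_algebra scale bracket + finite_dimensional_vector_space scale Basis
  for scale :: "'f::field \<Rightarrow> 'a::ab_group_add \<Rightarrow> 'a" and bracket Basis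
begin

section \<open>The derived algebra acts trivially on chief factors\<close>

text \<open>
  Commuting nilpotent operators on a nonzero space have a nonzero common kernel: on a minimal
  nonzero invariant subspace \<open>U\<close> each of them has a nonzero kernel, which is invariant under the
  others and thus all of \<open>U\<close>.  The common kernel on \<open>A/B\<close> is an ideal, because \<open>S\<close> is closed under
  brackets with \<open>L\<close> as far as the action on \<open>A/B\<close> can tell.  By minimality of \<open>A/B\<close> this ideal is
  everything.
\<close>

lemma nilpotent_family_acts_trivially:
  assumes chief: "chief_factor A B"
    and nil: "\<And>z. z \<in> S \<Longrightarrow> \<exists>N. \<forall>v\<in>A. (ad z ^^ N) v \<in> B"
    and comm: "\<And>z w. z \<in> S \<Longrightarrow> w \<in> S \<Longrightarrow> bracket z w \<in> factor_centralizer A B"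
    and closed: "\<And>z l. z \<in> S \<Longrightarrow> bracket z l \<in> S \<union> factor_centralizer A B"
  shows "S \<subseteq> factor_centralizer A B"
proof -
  note A = lie_idealD[OF chief_factorD(1)[OF chief]]
  note B = lie_idealD[OF chief_factorD(2)[OF chief]]
  have BA: "B \<subseteq> A" "B \<noteq> A" using chief_factorD[OF chief] by auto
  define W where "W = {v \<in> A. \<forall>z\<in>S. bracket v z \<in> B}"
  have "lie_ideal W"
    unfolding lie_ideal_def
  proof safe
    show "subspace W"
      by (auto simp: W_def subspace_def bracket_add_left bracket_scale_left
          subspace_0[OF A(1)] subspace_add[OF A(1)] subspace_scale[OF A(1)]
          subspace_0[OF B(1)] subspace_add[OF B(1)] subspace_scale[OF B(1)])
    fix v l assume v: "v \<in> W"
    have "bracket (bracket v l) z \<in> B" if z: "z \<in> S" for z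
    proof -
      have "bracket v (bracket z l) \<in> B"
        using closed[OF z, of l] v by (auto simp: W_def factor_centralizer_def)
      moreover have "bracket (bracket v z) l \<in> B" using v z B(2) by (simp add: W_def)
      ultimately have "bracket (bracket v z) l - bracket v (bracket z l) \<in> B"
        by (intro subspace_diff[OF B(1)])
      then show ?thesis by (simp add: bracket_bracket_left[of v z l])
    qed
    then show "bracket v l \<in> W" using v A(2) by (simp add: W_def)
  qed
  moreover have "B \<subseteq> W" "W \<subseteq> A" using BA B(2) by (auto simp: W_def)
  moreover have "\<exists>v\<in>W. v \<notin> B"
  proof -
    define inv_space where "inv_space U \<longleftrightarrow> subspace U \<and> B \<subseteq> U \<and> U \<subseteq> A \<and> U \<noteq> B
      \<and> (\<forall>v\<in>U. \<forall>z\<in>S. bracket v z \<in> U)" for U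
    have "inv_space A" using A BA by (auto simp: inv_space_def)
    then obtain U where U: "inv_space U" and min: "\<And>U'. inv_space U' \<Longrightarrow> dim U \<le> dim U'"
      using ex_has_least_nat[of inv_space A dim] by blast
    have sU: "subspace U" and BU: "B \<subseteq> U" and UA: "U \<subseteq> A" and "U \<noteq> B"
      and invU: "\<And>v z. v \<in> U \<Longrightarrow> z \<in> S \<Longrightarrow> bracket v z \<in> U"
      using U by (auto simp: inv_space_def)
    have "bracket v z \<in> B" if z: "z \<in> S" and v: "v \<in> U" for v z
    proof -
      define U' where "U' = {v \<in> U. bracket v z \<in> B}"
      have "bracket (bracket v w) z \<in> B" if "v \<in> U'" "w \<in> S" for v w
      proof -
        have "bracket v (bracket w z) \<in> B"
          using comm[OF that(2) z] that(1) UA by (auto simp: factor_centralizer_def U'_def)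
        then have "bracket (bracket v z) w + bracket v (bracket w z) \<in> B"
          using that B(2) by (intro subspace_add[OF B(1)]) (auto simp: U'_def)
        then show ?thesis by (simp add: bracket_bracket_left[of v w z])
      qed
      moreover have sU': "subspace U'"
        by (auto simp: U'_def subspace_def bracket_add_left bracket_scale_left
            subspace_0[OF sU] subspace_add[OF sU] subspace_scale[OF sU]
            subspace_0[OF B(1)] subspace_add[OF B(1)] subspace_scale[OF B(1)])
      moreover have "U' \<noteq> B"
      proof -
        obtain u where u: "u \<in> U" "u \<notin> B" using BU \<open>U \<noteq> B\<close> by blast
        \<comment> \<open>The last power of \<open>ad z\<close> that leaves \<open>u\<close> outside \<open>B\<close> gives an element of \<open>U'\<close>.\<close>
        obtain N where "(ad z ^^ N) u \<in> B" using nil[OF z] u UA by blast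
        then obtain k where k: "(ad z ^^ k) u \<notin> B" "(ad z ^^ Suc k) u \<in> B"
          using u(2) by (induction N) auto
        have "(ad z ^^ k) u \<in> U"
          by (rule funpow_invariant) (use u(1) invU z in \<open>auto simp: ad_def\<close>)
        then have "(ad z ^^ k) u \<in> U'" using k(2) by (simp add: U'_def ad_def)
        then show ?thesis using k(1) by blast
      qed
      moreover have "B \<subseteq> U'" "U' \<subseteq> U" using BU B(2) by (auto simp: U'_def)
      ultimately have "inv_space U'"
        using UA invU by (auto simp: inv_space_def U'_def)
      from min[OF this] have "U' = U"
        using subspace_dim_equal[OF sU' sU \<open>U' \<subseteq> U\<close>] by simp
      then show ?thesis using v by (auto simp: U'_def)
    qed
    then have "U \<subseteq> W" using UA by (auto simp: W_def)
    then show ?thesis using BU \<open>U \<noteq> B\<close> by blast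
  qed
  ultimately have "W = A" using chief_factor_dichotomy[OF chief] by blast
  then show ?thesis by (auto simp: W_def factor_centralizer_def)
qed

text \<open>
  Jacobson's lemma for \<open>X = - ad x\<close> and \<open>Y = ad y\<close>, whose commutator is \<open>ad [x, y]\<close>.
\<close>

lemma bracket_nilpotent_on_factor:
  assumes char0: "CHAR('f) = 0" and A: "lie_ideal A" and B: "lie_ideal B"
    and comm: "bracket (bracket x y) y \<in> factor_centralizer A B"
  shows "\<exists>N. \<forall>v\<in>A. (ad (bracket x y) ^^ N) v \<in> B"
proof (rule commutator_nilpotent[OF char0 module_hom_ad[of "- x"] module_hom_ad[of y] module_hom_ad])
  show "ad (- x) (ad y v) = ad y (ad (- x) v) + ad (bracket x y) v" for v
    using bracket_bracket_left[of v x y]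
    by (simp add: ad_def bracket_minus_right bracket_minus_left)
  show "ad (bracket x y) (ad y v) - ad y (ad (bracket x y) v) \<in> B" if "v \<in> A" for v
  proof -
    have "- bracket v (bracket (bracket x y) y) \<in> B"
      using comm that subspace_neg[OF lie_idealD(1)[OF B]] by (simp add: factor_centralizer_def)
    then show ?thesis using bracket_bracket_left[of v "bracket x y" y] by (simp add: ad_def)
  qed
qed (use lie_idealD[OF A] lie_idealD[OF B] in \<open>simp_all add: ad_def\<close>)

text \<open>
  The last term of the derived series is zero, so one may go down the series: if \<open>[J, J]\<close> acts
  trivially on \<open>A/B\<close> and \<open>J = [I, I]\<close>, then \<open>J\<close> acts trivially as well.  The elements of \<open>J\<close>
  commute in their action on \<open>A/B\<close>, so only nilpotency is missing.  In characteristic zero it is supplied twice by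
  Jacobson's lemma.  First, \<open>[x, y]\<close> with \<open>y \<in> J\<close> commutes with \<open>y\<close>, hence \<open>[L, J]\<close> acts trivially.  Now
  \<open>J\<close> acts centrally, so that \<open>[x, y]\<close> with \<open>x, y \<in> I\<close> commutes with \<open>y\<close>, hence \<open>J\<close> acts
  trivially.
\<close>

theorem derived_algebra_acts_trivially:
  assumes solv: solvable and chief: "chief_factor A B"
    and nil: "CHAR('f) \<noteq> 0 \<Longrightarrow> \<forall>z\<in>lie_prod UNIV UNIV. \<exists>N. \<forall>v. (ad z ^^ N) v = 0"
  shows "lie_prod UNIV UNIV \<subseteq> factor_centralizer A B"
proof -
  let ?C = "factor_centralizer A B"
  note AB = chief_factorD[OF chief]
  have C: "lie_ideal ?C" by (rule lie_ideal_factor_centralizer[OF AB(1,2)])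
  have step: "derived_series (Suc k) \<subseteq> ?C" if IH: "derived_series (Suc (Suc k)) \<subseteq> ?C" for k
  proof -
    define J where "J = derived_series (Suc k)"
    have J: "lie_ideal J" unfolding J_def by (rule lie_ideal_derived_series)
    have comm: "bracket z w \<in> ?C" if "z \<in> J" "w \<in> J" for z w
      using IH lie_prod_base[OF that] by (auto simp: J_def)
    show ?thesis
    proof (cases "CHAR('f) = 0")
      case False
      have "J \<subseteq> ?C"
      proof (rule nilpotent_family_acts_trivially[OF chief])
        fix z assume z: "z \<in> J"
        then have "z \<in> lie_prod UNIV UNIV" using derived_series_subset[of "Suc k"] by (auto simp: J_def)
        then show "\<exists>N. \<forall>v\<in>A. (ad z ^^ N) v \<in> B"
          using nil[OF False] subspace_0[OF lie_idealD(1)[OF AB(2)]] by (metis)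
      qed (use comm lie_idealD(2)[OF J] in auto)
      then show ?thesis by (simp add: J_def)
    next
      case char0: True
      have "{bracket x y | x y. y \<in> J} \<subseteq> ?C"
      proof (rule nilpotent_family_acts_trivially[OF chief])
        fix z assume z: "z \<in> {bracket x y | x y. y \<in> J}"
        then have zJ: "z \<in> J" using lie_idealD(3)[OF J] by auto
        show "\<exists>N. \<forall>v\<in>A. (ad z ^^ N) v \<in> B"
          using z zJ comm bracket_nilpotent_on_factor[OF char0 AB(1,2)] by blast
        show "bracket z w \<in> ?C" if "w \<in> {bracket x y | x y. y \<in> J}" for w
          using comm zJ lie_idealD(3)[OF J] that by auto
        show "bracket z l \<in> {bracket x y | x y. y \<in> J} \<union> ?C" for l
          using zJ bracket_skew[of z l] bracket_minus_left[of l z]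
          by (metis (mono_tags, lifting) UnI1 mem_Collect_eq)
      qed
      then have central: "bracket z l \<in> ?C" if "z \<in> J" for z l
      proof -
        have "bracket z l = bracket (- l) z"
          using bracket_skew[of z l] bracket_minus_left[of l z] by simp
        then show ?thesis
          using that \<open>{bracket x y | x y. y \<in> J} \<subseteq> ?C\<close> by blast
      qed
      let ?S = "{bracket x y | x y. x \<in> derived_series k \<and> y \<in> derived_series k}"
      have SJ: "?S \<subseteq> J" using lie_prod_base by (auto simp: J_def)
      have "?S \<subseteq> ?C"
      proof (rule nilpotent_family_acts_trivially[OF chief])
        fix z assume z: "z \<in> ?S"
        then show "\<exists>N. \<forall>v\<in>A. (ad z ^^ N) v \<in> B"
          using SJ central bracket_nilpotent_on_factor[OF char0 AB(1,2)] by blast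
      qed (use SJ central in blast)+
      then show ?thesis
        using span_minimal[OF _ lie_idealD(1)[OF C]] by (simp add: lie_prod_def)
    qed
  qed
  obtain n where n: "derived_series n = {0}" using solv by (auto simp: solvable_def)
  have "derived_series (Suc n) \<subseteq> ?C"
    using derived_series_Suc_subset[of n] subspace_0[OF lie_idealD(1)[OF C]] n by auto
  then have "derived_series (Suc 0) \<subseteq> ?C"
    by (induction n) (use step in blast)+
  then show ?thesis by simp
qed

lemma nilpotent_acts_trivially:
  assumes chief: "chief_factor A B" and der: "lie_prod UNIV UNIV \<subseteq> factor_centralizer A B"
    and nil: "\<And>v. (ad x ^^ n) v = 0"
  shows "x \<in> factor_centralizer A B"
proof -
  have "{x} \<subseteq> factor_centralizer A B"
  proof (rule nilpotent_family_acts_trivially[OF chief])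
    show "\<exists>N. \<forall>v\<in>A. (ad z ^^ N) v \<in> B" if "z \<in> {x}" for z
      using that nil subspace_0[OF lie_idealD(1)[OF chief_factorD(2)[OF chief]]]
      by (auto intro!: exI[of _ n])
  qed (use der lie_prod_base[of x UNIV _ UNIV] in auto)
  then show ?thesis by simp
qed

text \<open>
  An element acting trivially on all chief factors is ad-nilpotent: each application of \<open>ad a\<close>
  takes an ideal into a maximal ideal of \<open>L\<close> below it, so \<open>ad a\<close> descends a chief series.
\<close>

lemma derived_algebra_ad_nilpotent:
  assumes der: "\<And>A B. chief_factor A B \<Longrightarrow> lie_prod UNIV UNIV \<subseteq> factor_centralizer A B"
    and a: "a \<in> lie_prod UNIV UNIV"
  shows "\<exists>n. \<forall>v. (ad a ^^ n) v = 0"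
proof -
  have "\<exists>n. \<forall>v\<in>I. (ad a ^^ n) v = 0" if "lie_ideal I" for I
    using that
  proof (induction "dim I" arbitrary: I rule: less_induct)
    case less
    show ?case
    proof (cases "I = {0}")
      case True
      then show ?thesis by (auto intro: exI[of _ 0])
    next
      case False
      define Q where "Q J \<longleftrightarrow> lie_ideal J \<and> J \<subset> I" for J
      have "{0} \<subset> I" using False subspace_0[OF lie_idealD(1)[OF less(2)]] by auto
      then have "Q {0}" by (simp add: Q_def lie_ideal_def)
      moreover have bound: "dim J < dim I" if "Q J" for J
      proof -
        have "span J = J" "span I = I" using that less(2) lie_idealD(1) by (auto simp: Q_def)
        then show ?thesis using dim_psubset[of J I] that unfolding Q_def by metis
      qed
      ultimately obtain J where J: "Q J" and max: "\<And>J'. Q J' \<Longrightarrow> dim J' \<le> dim J"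
        using ex_has_greatest_nat[of Q "{0}" dim "dim I"] by (metis less_imp_le)
      have "chief_factor I J"
        unfolding chief_factor_iff
      proof (intro conjI allI impI)
        fix C assume C: "lie_ideal C \<and> J \<subseteq> C \<and> C \<subseteq> I"
        show "C = J \<or> C = I"
        proof (cases "C = I")
          case False
          then have "Q C" using C by (auto simp: Q_def)
          then have "J = C"
            using subspace_dim_equal[of J C] max C J lie_idealD(1) by (auto simp: Q_def)
          then show ?thesis by simp
        qed simp
      qed (use J less(2) in \<open>auto simp: Q_def\<close>)
      then have "a \<in> factor_centralizer I J" using der a by blast
      moreover obtain n where "\<forall>v\<in>J. (ad a ^^ n) v = 0"
        using less(1)[OF bound[OF J]] J by (auto simp: Q_def)
      ultimately have "(ad a ^^ n) (ad a v) = 0" if "v \<in> I" for v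
        using that by (simp add: factor_centralizer_def ad_def)
      then have "(ad a ^^ Suc n) v = 0" if "v \<in> I" for v
        using that by (simp only: funpow_Suc_right o_apply)
      then show ?thesis by blast
    qed
  qed
  from this[OF lie_ideal_UNIV] show ?thesis by simp
qed

end

section \<open>Exponentials of nilpotent derivations\<close>

context lie_algebra
begin

lemma module_hom_ad_pow: "module_hom scale scale (ad x ^^ k)"
  by (rule module_hom_funpow[OF module_hom_ad])

lemma ad_pow_zero_mono:
  assumes "\<And>v. (ad x ^^ n) v = 0" "n \<le> m"
  shows "(ad x ^^ m) v = 0"
proof -
  have "(ad x ^^ (m - n + n)) v = 0"
    unfolding funpow_add by (simp add: assms(1) module_hom.zero[OF module_hom_ad_pow])
  then show ?thesis using assms(2) by simp
qed

lemma ad_pow_in_lower_central: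
  assumes "lie_ideal I" "x \<in> I"
  shows "(ad x ^^ Suc k) v \<in> lower_central I k"
proof (induction k)
  case 0
  show ?case using lie_idealD(3)[OF assms] by (simp add: ad_def)
next
  case (Suc k)
  then show ?case using lie_prod_base[OF Suc assms(2)] by (simp add: ad_def)
qed

lemma ad_pow_class_zero:
  assumes "lie_ideal I" "nilpotent I" "nilpotency_class I < p" "x \<in> I"
  shows "(ad x ^^ p) v = 0"
proof (rule ad_pow_zero_mono)
  have "lower_central I (nilpotency_class I) = {0}"
    using assms(2) unfolding nilpotent_def nilpotency_class_def by (metis (mono_tags) LeastI_ex)
  then show "(ad x ^^ Suc (nilpotency_class I)) v = 0" for v
    using ad_pow_in_lower_central[OF assms(1,4)] by blast
qed (use assms(3) in simp)

text \<open>
  The part of the exponential series that will turn out to be negligible on a chief factor, kept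
  apart from the terms \<open>v + [v, x]\<close>.
\<close>

definition exp_remainder :: "nat \<Rightarrow> 'a \<Rightarrow> 'a \<Rightarrow> 'a"
  where "exp_remainder n x v = (\<Sum>r<n. scale (1 / of_nat (fact (r + 2))) ((ad x ^^ (r + 2)) v))"

text \<open>
  When the exponential is defined, \<open>(ad x)\<^sup>n = 0\<close> for the bound \<open>n\<close> at which the series is cut off, in
  either characteristic.  The sum may then be continued by two zero terms, which makes the terms of
  degree zero and one always available.
\<close>

lemma exp_ad_expansion:
  assumes "exp_ad_defined x"
  obtains n where "\<And>v. (ad x ^^ n) v = 0"
    "\<And>v. exp_ad x v = v + bracket v x + exp_remainder n x v"
proof -
  define n where "n = (if CHAR('f) = 0 then LEAST n. \<forall>z. (ad x ^^ n) z = 0 else CHAR('f))"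
  have nil: "(ad x ^^ n) v = 0" for v
  proof (cases "CHAR('f) = 0")
    case True
    then have "\<exists>n. \<forall>z. (ad x ^^ n) z = 0" using assms by (simp add: exp_ad_defined_def)
    then have "\<forall>z. (ad x ^^ (LEAST n. \<forall>z. (ad x ^^ n) z = 0)) z = 0" by (rule LeastI_ex)
    then show ?thesis using True by (simp add: n_def)
  next
    case False
    then show ?thesis using assms ad_pow_class_zero by (auto simp: exp_ad_defined_def n_def)
  qed
  have "exp_ad x v = v + bracket v x + exp_remainder n x v" for v
  proof -
    let ?t = "\<lambda>r. scale (1 / of_nat (fact r)) ((ad x ^^ r) v)"
    have "exp_ad x v = (\<Sum>r<n. ?t r)" by (simp add: exp_ad_def n_def)
    also have "\<dots> = (\<Sum>r<Suc (Suc n). ?t r)"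
      using nil ad_pow_zero_mono[of n x "Suc n"] by simp
    also have "\<dots> = v + bracket v x + exp_remainder n x v"
      unfolding sum.lessThan_Suc_shift exp_remainder_def by (simp add: ad_def add.assoc)
    finally show ?thesis .
  qed
  with nil show ?thesis by (rule that)
qed

lemma module_hom_exp_remainder: "module_hom scale scale (exp_remainder n x)"
  unfolding module_hom_iff
  by (auto simp: module_axioms exp_remainder_def module_hom.add[OF module_hom_ad_pow]
      module_hom.scale[OF module_hom_ad_pow] scale_right_distrib sum.distrib scale_sum_right
      scale_left_commute simp del: funpow.simps intro!: sum.cong)

text \<open>
  \<open>exp (ad x) - id\<close> maps the kernel of \<open>(ad x)\<^sup>k\<^sup>+\<^sup>1\<close> into the kernel of \<open>(ad x)\<^sup>k\<close>.  Induction along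
  these kernels, which exhaust \<open>L\<close>, gives injectivity and surjectivity.
\<close>

lemma bij_exp_ad:
  assumes "exp_ad_defined x"
  shows "bij (exp_ad x)"
proof -
  obtain n where nil: "\<And>v. (ad x ^^ n) v = 0"
    and expand: "\<And>v. exp_ad x v = v + bracket v x + exp_remainder n x v"
    using exp_ad_expansion[OF assms] by blast
  have add: "exp_ad x (u + v) = exp_ad x u + exp_ad x v" for u v
    using module_hom.add[OF module_hom_exp_remainder, of n x]
    by (simp add: expand bracket_add_left)
  have lower: "(ad x ^^ k) (exp_ad x v - v) = 0" if "(ad x ^^ Suc k) v = 0" for k v
  proof -
    have z: "(ad x ^^ k) ((ad x ^^ Suc r) v) = 0" for r
    proof -
      have "(ad x ^^ k) ((ad x ^^ Suc r) v) = (ad x ^^ (r + Suc k)) v"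
        by (simp only: funpow_add[symmetric, THEN fun_cong, simplified o_def]) (simp add: add.commute)
      also have "\<dots> = (ad x ^^ r) ((ad x ^^ Suc k) v)" by (simp only: funpow_add o_def)
      also have "\<dots> = 0" unfolding that by (rule module_hom.zero[OF module_hom_ad_pow])
      finally show ?thesis .
    qed
    have "exp_ad x v - v
        = (ad x ^^ Suc 0) v + (\<Sum>r<n. scale (1 / of_nat (fact (r + 2))) ((ad x ^^ Suc (Suc r)) v))"
      by (simp add: expand exp_remainder_def ad_def)
    then show ?thesis
      by (simp only: module_hom.add[OF module_hom_ad_pow] module_hom.sum[OF module_hom_ad_pow]
          module_hom.scale[OF module_hom_ad_pow] z) simp
  qed
  have "v = 0" if "exp_ad x v = 0" "(ad x ^^ k) v = 0" for v k
    using that(2)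
  proof (induction k)
    case (Suc k)
    then show ?case
      using lower[OF Suc(2)] that(1) module_hom.neg[OF module_hom_ad_pow, of k x v] by simp
  qed simp
  then have "u = v" if "exp_ad x u = exp_ad x v" for u v
    using add[of "u - v" v] that nil[of "u - v"] by fastforce
  then have "inj (exp_ad x)" by (rule injI)
  moreover have "v \<in> range (exp_ad x)" if "(ad x ^^ k) v = 0" for v k
    using that
  proof (induction k arbitrary: v)
    case 0
    then show ?case using add[of 0 0] by (auto intro!: image_eqI[of _ _ 0])
  next
    case (Suc k)
    have "(ad x ^^ k) (v - exp_ad x v) = 0"
      using lower[OF Suc(2)] module_hom.neg[OF module_hom_ad_pow, of k x "exp_ad x v - v"] by simp
    then obtain w where "v - exp_ad x v = exp_ad x w" using Suc(1) by blast
    then have "v = exp_ad x (v + w)" by (simp add: add algebra_simps)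
    then show ?case by blast
  qed
  then have "surj (exp_ad x)" using nil by blast
  ultimately show ?thesis by (simp add: bij_def)
qed

section \<open>Chief factors with a complement\<close>

text \<open>
  Brackets of \<open>C \<inter> M\<close> with \<open>M\<close> stay inside for formal reasons, so if \<open>L = M + A\<close>, only brackets with
  \<open>A\<close> have to be checked.
\<close>

lemma lie_ideal_Int_of_complement:
  assumes cover: "\<And>l. \<exists>m\<in>M. \<exists>a\<in>A. l = m + a" and M: "subalgebra M" and C: "lie_ideal C"
    and CA: "\<And>c a. c \<in> C \<Longrightarrow> c \<in> M \<Longrightarrow> a \<in> A \<Longrightarrow> bracket c a \<in> C \<inter> M"
  shows "lie_ideal (C \<inter> M)"
  unfolding lie_ideal_def
proof safe
  show s: "subspace (C \<inter> M)"
    using subspace_inter lie_idealD(1)[OF C] M by (simp add: subalgebra_def)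
  fix c l assume c: "c \<in> C" "c \<in> M"
  obtain m a where "m \<in> M" "a \<in> A" "l = m + a" using cover by blast
  then have "bracket c m \<in> C \<inter> M" "bracket c a \<in> C \<inter> M" "l = m + a"
    using c CA M lie_idealD(2)[OF C] by (auto simp: subalgebra_def)
  then have "bracket c l \<in> C \<inter> M" using subspace_add[OF s] by (simp add: bracket_add_right)
  then show "bracket c l \<in> C" "bracket c l \<in> M" by auto
qed

lemma maximal_subalgebra_sum:
  assumes M: "maximal_subalgebra M" and A: "lie_ideal A" and "\<not> A \<subseteq> M"
  shows "\<exists>m\<in>M. \<exists>a\<in>A. l = m + a"
proof -
  let ?S = "{m + a | m a. m \<in> M \<and> a \<in> A}"
  have sM: "subspace M" and brM: "\<And>x y. x \<in> M \<Longrightarrow> y \<in> M \<Longrightarrow> bracket x y \<in> M"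
    using M by (auto simp: maximal_subalgebra_def subalgebra_def)
  have "subalgebra ?S"
    unfolding subalgebra_def
  proof (intro conjI ballI)
    show "subspace ?S" by (rule subspace_sums[OF sM lie_idealD(1)[OF A]])
    fix x y assume "x \<in> ?S" "y \<in> ?S"
    then obtain m a m' a' where *: "m \<in> M" "a \<in> A" "x = m + a" "m' \<in> M" "a' \<in> A" "y = m' + a'"
      by blast
    have "bracket x y = bracket m m' + (bracket m a' + bracket a y)"
      by (simp add: * bracket_add_left bracket_add_right)
    moreover have "bracket m a' + bracket a y \<in> A"
      using * lie_idealD[OF A] by (intro subspace_add) auto
    ultimately show "bracket x y \<in> ?S" using brM * by blast
  qed
  moreover have "M \<subseteq> ?S" using subspace_0[OF lie_idealD(1)[OF A]] by force
  moreover have "A \<subseteq> ?S" using subspace_0[OF sM] by force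
  ultimately have "subalgebra ?S" "M \<subseteq> ?S" "?S \<noteq> M" using assms(3) by auto
  then have "?S = UNIV" using M unfolding maximal_subalgebra_def by (elim conjE allE[of _ ?S]) simp
  then show ?thesis by blast
qed

text \<open>
  \<open>[A, L] + B\<close> is an ideal between \<open>B\<close> and \<open>A\<close>.  If it is \<open>B\<close>, then \<open>A/B\<close> is central; if it is \<open>A\<close>, then
  \<open>A\<close> is covered by \<open>A \<inter> L\<^sup>2\<close> modulo \<open>B\<close>.
\<close>

lemma chief_factor_central_or_derived:
  assumes chief: "chief_factor A B"
  shows "(\<forall>a\<in>A. \<forall>l. bracket a l \<in> B) \<or> (\<forall>a\<in>A. \<exists>n\<in>A \<inter> lie_prod UNIV UNIV. a - n \<in> B)"
proof (rule disjCI)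
  assume not_derived: "\<not> (\<forall>a\<in>A. \<exists>n\<in>A \<inter> lie_prod UNIV UNIV. a - n \<in> B)"
  note AB = chief_factorD[OF chief]
  let ?E = "lie_prod A UNIV"
  let ?C = "{e + b | e b. e \<in> ?E \<and> b \<in> B}"
  have E: "lie_ideal ?E" by (rule lie_ideal_lie_prod[OF AB(1) lie_ideal_UNIV])
  have EA: "?E \<subseteq> A" using lie_idealD[OF AB(1)] by (intro lie_prod_induct) auto
  have EL: "?E \<subseteq> lie_prod UNIV UNIV"
    unfolding lie_prod_def by (rule span_mono) blast
  have "lie_ideal ?C"
    unfolding lie_ideal_def
  proof (intro conjI ballI allI)
    show "subspace ?C" by (rule subspace_sums[OF lie_idealD(1)[OF E] lie_idealD(1)[OF AB(2)]])
    fix x l assume "x \<in> ?C"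
    then obtain e b where "e \<in> ?E" "b \<in> B" "x = e + b" by blast
    then have "bracket e l \<in> ?E" "bracket b l \<in> B" "bracket x l = bracket e l + bracket b l"
      using lie_idealD(2)[OF E] lie_idealD(2)[OF AB(2)] by (auto simp: bracket_add_left)
    then show "bracket x l \<in> ?C" by blast
  qed
  moreover have "B \<subseteq> ?C" using subspace_0[OF lie_idealD(1)[OF E]] by force
  moreover have "?C \<subseteq> A" using EA AB(3) subspace_add[OF lie_idealD(1)[OF AB(1)]] by blast
  moreover have "?C \<noteq> A"
  proof
    assume "?C = A"
    have "\<exists>n\<in>A \<inter> lie_prod UNIV UNIV. a - n \<in> B" if "a \<in> A" for a
    proof -
      obtain e b where "a = e + b" "e \<in> ?E" "b \<in> B" using \<open>a \<in> A\<close> \<open>?C = A\<close> by blast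
      then show ?thesis using EA EL by (intro bexI[of _ e]) auto
    qed
    with not_derived show False by blast
  qed
  ultimately have "?C = B" using chief unfolding chief_factor_iff by blast
  moreover have "?E \<subseteq> ?C" using subspace_0[OF lie_idealD(1)[OF AB(2)]] by force
  ultimately show "\<forall>a\<in>A. \<forall>l. bracket a l \<in> B" using lie_prod_base[of _ A _ UNIV] by blast
qed

end

text \<open>
  Solvability of \<open>L\<close> enters only through the condition \<open>derived_trivial\<close>.
\<close>

locale complemented_chief_factor = lie_algebra scale bracket
  for scale :: "'f::field \<Rightarrow> 'a::ab_group_add \<Rightarrow> 'a" and bracket +
  fixes A B M :: "'a set"
  assumes chief: "chief_factor A B"
    and maximal: "maximal_subalgebra M"
    and complement: "B \<subseteq> M" "\<not> A \<subseteq> M"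
    and derived_trivial: "lie_prod UNIV UNIV \<subseteq> factor_centralizer A B"
begin

abbreviation (input) "C \<equiv> factor_centralizer A B"
abbreviation (input) "D \<equiv> factor_centralizer A B \<inter> M"

lemma ideal_A: "lie_ideal A" and ideal_B: "lie_ideal B"
  using chief_factorD[OF chief] by auto

lemma centralizer_ideal: "lie_ideal C"
  by (rule lie_ideal_factor_centralizer[OF ideal_A ideal_B])

lemma subspace_M: "subspace M" and subalgebra_M: "subalgebra M"
  using maximal by (auto simp: maximal_subalgebra_def subalgebra_def)

lemma B_subset_centralizer: "B \<subseteq> C"
  using lie_idealD(3)[OF ideal_B] by (auto simp: factor_centralizer_def)

text \<open>
  \<open>A/B\<close> is abelian: it is central, or else covered by \<open>L\<^sup>2\<close>, which acts trivially on it.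
\<close>

lemma A_subset_centralizer: "A \<subseteq> C"
proof -
  have "bracket v a \<in> B" if v: "v \<in> A" and a: "a \<in> A" for v a
    using chief_factor_central_or_derived[OF chief]
  proof
    assume "\<forall>a\<in>A. \<forall>l. bracket a l \<in> B"
    then show ?thesis using v by blast
  next
    assume "\<forall>a\<in>A. \<exists>n\<in>A \<inter> lie_prod UNIV UNIV. a - n \<in> B"
    then obtain n where n: "n \<in> lie_prod UNIV UNIV" "a - n \<in> B" using a by blast
    then have "bracket v n + bracket v (a - n) \<in> B"
      using derived_trivial v lie_idealD[OF ideal_B]
      by (intro subspace_add) (auto simp: factor_centralizer_def)
    then show ?thesis by (simp add: bracket_diff_right)
  qed
  then show ?thesis by (auto simp: factor_centralizer_def)
qed

lemma D_ideal: "lie_ideal D"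
proof (rule lie_ideal_Int_of_complement[OF _ subalgebra_M centralizer_ideal])
  show "\<exists>m\<in>M. \<exists>a\<in>A. l = m + a" for l
    by (rule maximal_subalgebra_sum[OF maximal ideal_A complement(2)])
  fix c a assume "c \<in> C" "a \<in> A"
  then have "- bracket a c \<in> B"
    using subspace_neg[OF lie_idealD(1)[OF ideal_B]] by (simp add: factor_centralizer_def)
  then show "bracket c a \<in> D"
    using B_subset_centralizer complement(1) by (simp flip: bracket_skew) blast
qed

lemma B_subset_D: "B \<subseteq> D"
  using B_subset_centralizer complement(1) by blast

text \<open>
  As \<open>L = M + A\<close> and \<open>A \<subseteq> C\<close>, an element of \<open>C\<close> is congruent modulo \<open>D\<close> to an element \<open>a\<close> of \<open>A\<close>.
  It has to be replaced by an element of \<open>A \<inter> L\<^sup>2\<close>, since those are the elements of \<open>A\<close> for which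
  the exponential is known to be defined.  When \<open>A/B\<close> is central, \<open>a\<close> need not be congruent to
  anything in \<open>L\<^sup>2\<close>, but it acts like \<open>0\<close> modulo \<open>D\<close>; for this reason the conclusion compares
  the actions and not the elements.
\<close>

lemma centralizer_representative:
  assumes "x \<in> C"
  obtains n where "n \<in> A" "n \<in> lie_prod UNIV UNIV" "\<And>l. bracket l x - bracket l n \<in> D"
proof -
  obtain m a where ma: "m \<in> M" "a \<in> A" "x = m + a"
    using maximal_subalgebra_sum[OF maximal ideal_A complement(2)] by blast
  have "x - a \<in> C"
    using subspace_diff[OF lie_idealD(1)[OF centralizer_ideal] assms] A_subset_centralizer ma(2)
    by blast
  then have mD: "m \<in> D" using ma by simp
  have "\<exists>n\<in>A \<inter> lie_prod UNIV UNIV. \<forall>l. bracket l x - bracket l n \<in> D"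
    using chief_factor_central_or_derived[OF chief]
  proof
    assume c: "\<forall>a\<in>A. \<forall>l. bracket a l \<in> B"
    have "bracket l x - bracket l 0 \<in> D" for l
    proof -
      have "- bracket a l \<in> B"
        using c ma(2) subspace_neg[OF lie_idealD(1)[OF ideal_B]] by blast
      then have "bracket l m + bracket l a \<in> D"
        using B_subset_D mD lie_idealD[OF D_ideal]
        by (intro subspace_add[OF lie_idealD(1)[OF D_ideal]]) (simp_all flip: bracket_skew, auto)
      then show ?thesis by (simp add: ma(3) bracket_add_right)
    qed
    moreover have "0 \<in> A \<inter> lie_prod UNIV UNIV"
      using subspace_0[OF lie_idealD(1)[OF ideal_A]] by (simp add: lie_prod_def span_zero)
    ultimately show ?thesis by blast
  next
    assume "\<forall>a\<in>A. \<exists>n\<in>A \<inter> lie_prod UNIV UNIV. a - n \<in> B"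
    then obtain n where n: "n \<in> A \<inter> lie_prod UNIV UNIV" "a - n \<in> B" using ma(2) by blast
    then have "m + (a - n) \<in> D"
      using mD B_subset_D subspace_add[OF lie_idealD(1)[OF D_ideal]] by blast
    then have "bracket l (x - n) \<in> D" for l
      using lie_idealD(3)[OF D_ideal] by (simp add: ma(3) add_diff_eq)
    then show ?thesis using n(1) by (auto simp: bracket_diff_right)
  qed
  then show ?thesis using that by blast
qed

subsection \<open>Conjugates of the complement\<close>

text \<open>
  The image of \<open>M\<close> under \<open>l \<mapsto> l + [l, a]\<close>, up to elements of \<open>D\<close>.  It is defined as a preimage under
  \<open>l \<mapsto> l - [l, a]\<close>, the inverse map modulo \<open>D\<close>, because membership in it is then a
  single condition on \<open>l\<close>.
\<close>

definition shear :: "'a \<Rightarrow> 'a set"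
  where "shear a = {l. l - bracket l a \<in> M}"

text \<open>
  Modulo \<open>D\<close> the bracket \<open>[l, x]\<close> is \<open>[l, n] \<in> A\<close>, and \<open>x\<close> centralizes \<open>A/B\<close>, so already
  \<open>(ad x)\<^sup>2 l\<close> lies in \<open>D\<close>.
\<close>

lemma exp_ad_modulo:
  assumes "exp_ad_defined x" "x \<in> C" "n \<in> A" and rep: "\<And>l. bracket l x - bracket l n \<in> D"
  shows "exp_ad x l - (l + bracket l n) \<in> D"
proof -
  note sD = lie_idealD(1)[OF D_ideal]
  obtain k where expand: "\<And>v. exp_ad x v = v + bracket v x + exp_remainder k x v"
    using exp_ad_expansion[OF assms(1)] by blast
  have sq: "(ad x ^^ (r + 2)) l \<in> D" for r
  proof (induction r)
    case 0
    have "bracket l n \<in> A" using lie_idealD(3)[OF ideal_A assms(3)] .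
    then have "bracket (bracket l n) x \<in> D"
      using assms(2) B_subset_D by (auto simp: factor_centralizer_def)
    moreover have "bracket (bracket l x - bracket l n) x \<in> D"
      using lie_idealD(2)[OF D_ideal rep] .
    ultimately have "bracket (bracket l n) x + bracket (bracket l x - bracket l n) x \<in> D"
      by (rule subspace_add[OF sD])
    then show ?case by (simp add: ad_def bracket_diff_left numeral_2_eq_2)
  next
    case (Suc r)
    then show ?case using lie_idealD(2)[OF D_ideal Suc] by (simp add: ad_def)
  qed
  have "exp_remainder k x l \<in> D"
    unfolding exp_remainder_def by (rule subspace_sum[OF sD], rule subspace_scale[OF sD sq])
  from subspace_add[OF sD rep[of l] this] show ?thesis by (simp add: expand algebra_simps)
qed

text \<open>
  With \<open>g = exp (ad x) l\<close>, the elements \<open>g - [g, n' + n]\<close> and \<open>l - [l, n']\<close> are congruent modulo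
  \<open>D \<subseteq> M\<close>: up to \<open>D\<close> they differ by \<open>[[l, n], n' + n] \<in> [A, A] \<subseteq> B\<close>.
\<close>

lemma exp_ad_shear_iff:
  assumes "exp_ad_defined x" "x \<in> C" "n \<in> A" "n' \<in> A"
    and rep: "\<And>l. bracket l x - bracket l n \<in> D"
  shows "exp_ad x l \<in> shear (n' + n) \<longleftrightarrow> l \<in> shear n'"
proof -
  note sD = lie_idealD(1)[OF D_ideal]
  define g where "g = exp_ad x l"
  define d where "d = g - (l + bracket l n)"
  have d: "d \<in> D" unfolding d_def g_def by (rule exp_ad_modulo[OF assms(1-3) rep])
  have nn: "n' + n \<in> A" using assms subspace_add[OF lie_idealD(1)[OF ideal_A]] by blast
  have "bracket (bracket l n) (n' + n) \<in> B"
    using nn A_subset_centralizer lie_idealD(3)[OF ideal_A assms(3)] by (auto simp: factor_centralizer_def)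
  then have "d - bracket (bracket l n) (n' + n) - bracket d (n' + n) \<in> D"
    using d B_subset_D lie_idealD(2)[OF D_ideal d] by (intro subspace_diff[OF sD]) auto
  moreover have g: "g = l + bracket l n + d" by (simp add: d_def)
  have "(g - bracket g (n' + n)) - (l - bracket l n')
      = d - bracket (bracket l n) (n' + n) - bracket d (n' + n)"
    unfolding g by (simp add: bracket_add_left bracket_add_right)
  ultimately have diff: "(g - bracket g (n' + n)) - (l - bracket l n') \<in> M" by simp
  show ?thesis
    unfolding shear_def mem_Collect_eq g_def[symmetric]
    using subspace_add[OF subspace_M diff, of "l - bracket l n'"]
      subspace_diff[OF subspace_M _ diff, of "g - bracket g (n' + n)"] by auto
qed

lemma shear_0: "shear 0 = M"
  by (simp add: shear_def)

lemma exp_ad_image: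
  assumes "exp_ad_defined a" "a \<in> A"
  shows "exp_ad a ` M = shear a"
proof -
  have "bracket l a - bracket l a \<in> D" for l
    using subspace_0[OF lie_idealD(1)[OF D_ideal]] by simp
  then have iff: "exp_ad a l \<in> shear a \<longleftrightarrow> l \<in> M" for l
    using exp_ad_shear_iff[OF assms(1) _ assms(2), of 0 l] assms(2) A_subset_centralizer
      subspace_0[OF lie_idealD(1)[OF ideal_A]] by (auto simp: shear_0)
  have "surj (exp_ad a)" using bij_exp_ad[OF assms(1)] by (simp add: bij_def)
  then show ?thesis using iff by (auto simp: image_iff) (metis surjD)
qed

text \<open>
  The shifts of the parameter add up under composition and change sign under inversion, so that the
  statement for the generators extends to the whole group.  For this to work the parameter \<open>n'\<close> has to
  range over all of \<open>A\<close>.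
\<close>

lemma inner_automorphism_shear:
  assumes "\<And>x. exp_ad_defined x \<Longrightarrow> x \<in> C" "\<alpha> \<in> inner_automorphisms"
  shows "bij \<alpha> \<and> (\<exists>n\<in>A \<inter> lie_prod UNIV UNIV. \<forall>n'\<in>A. \<forall>l. \<alpha> l \<in> shear (n' + n) \<longleftrightarrow> l \<in> shear n')"
proof -
  let ?N = "A \<inter> lie_prod UNIV UNIV"
  define shifts where "shifts \<alpha> \<longleftrightarrow>
    bij \<alpha> \<and> (\<exists>n\<in>?N. \<forall>n'\<in>A. \<forall>l. \<alpha> l \<in> shear (n' + n) \<longleftrightarrow> l \<in> shear n')" for \<alpha>
  have sN: "subspace ?N"
    using subspace_inter[OF lie_idealD(1)[OF ideal_A]] by (simp add: lie_prod_def)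
  note sA = lie_idealD(1)[OF ideal_A]
  have gen: "shifts (exp_ad x)" if x: "exp_ad_defined x" for x
  proof -
    obtain n where "n \<in> A" "n \<in> lie_prod UNIV UNIV" "\<And>l. bracket l x - bracket l n \<in> D"
      using centralizer_representative assms(1)[OF x] by blast
    then show ?thesis
      unfolding shifts_def using bij_exp_ad[OF x] exp_ad_shear_iff[OF x assms(1)[OF x]] by blast
  qed
  have Bij: "\<beta> \<in> Bij UNIV \<longleftrightarrow> bij \<beta>" for \<beta> :: "'a \<Rightarrow> 'a" by (simp add: Bij_def)
  have "shifts \<alpha>"
    using assms(2) unfolding inner_automorphisms_def
  proof (induction rule: generate.induct)
    case one
    have "\<exists>n\<in>?N. \<forall>n'\<in>A. \<forall>l. l \<in> shear (n' + n) \<longleftrightarrow> l \<in> shear n'"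
      using subspace_0[OF sN] by (intro bexI[of _ 0]) auto
    then show ?case by (simp add: shifts_def BijGroup_def id_def[symmetric])
  next
    case (incl h)
    then show ?case using gen by blast
  next
    case (inv h)
    then have "shifts h" using gen by blast
    then obtain n where h: "bij h" and n: "n \<in> ?N"
      and shift: "\<And>n' l. n' \<in> A \<Longrightarrow> h l \<in> shear (n' + n) \<longleftrightarrow> l \<in> shear n'"
      by (auto simp: shifts_def)
    have "inv_into UNIV h l \<in> shear (n' + - n) \<longleftrightarrow> l \<in> shear n'" if "n' \<in> A" for n' l
      using shift[of "n' + - n" "inv_into UNIV h l"] that n subspace_diff[OF sA, of n' n] h
      by (simp add: bij_is_surj surj_f_inv_f)
    then have "shifts (inv_into UNIV h)"
      using subspace_neg[OF sN n] h bij_imp_bij_inv unfolding shifts_def by blast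
    then show ?case using h by (simp add: inv_BijGroup Bij)
  next
    case (eng h1 h2)
    obtain n1 where h1: "bij h1" and n1: "n1 \<in> ?N"
      and shift1: "\<And>n' l. n' \<in> A \<Longrightarrow> h1 l \<in> shear (n' + n1) \<longleftrightarrow> l \<in> shear n'"
      using eng(3) by (auto simp: shifts_def)
    obtain n2 where h2: "bij h2" and n2: "n2 \<in> ?N"
      and shift2: "\<And>n' l. n' \<in> A \<Longrightarrow> h2 l \<in> shear (n' + n2) \<longleftrightarrow> l \<in> shear n'"
      using eng(4) by (auto simp: shifts_def)
    have "(h1 \<circ> h2) l \<in> shear (n' + (n2 + n1)) \<longleftrightarrow> l \<in> shear n'" if "n' \<in> A" for n' l
      using shift1[of "n' + n2" "h2 l"] shift2[OF that] that n2 subspace_add[OF sA, of n' n2]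
      by (simp add: add.assoc)
    then have "shifts (h1 \<circ> h2)"
      using subspace_add[OF sN n2 n1] bij_comp[OF h2 h1] unfolding shifts_def by blast
    then show ?case using h1 h2 by (simp add: BijGroup_def Bij compose_def o_def)
  qed
  then show ?thesis by (simp add: shifts_def)
qed

theorem conjugate_is_exp_image:
  assumes "\<And>x. exp_ad_defined x \<Longrightarrow> x \<in> C"
    and defined: "\<And>a. a \<in> lie_prod UNIV UNIV \<Longrightarrow> exp_ad_defined a"
    and "conjugate K M"
  shows "\<exists>a\<in>A. exp_ad_defined a \<and> K = exp_ad a ` M \<and> M \<inter> K = {m \<in> M. bracket m a \<in> M}"
proof -
  obtain \<alpha> where "\<alpha> \<in> inner_automorphisms" and K: "K = \<alpha> ` M"
    using assms(3) by (auto simp: conjugate_def)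
  from inner_automorphism_shear[OF assms(1) this(1)] obtain n
    where \<alpha>: "bij \<alpha>" and n: "n \<in> A" "n \<in> lie_prod UNIV UNIV"
      and shift: "\<And>n' l. n' \<in> A \<Longrightarrow> \<alpha> l \<in> shear (n' + n) \<longleftrightarrow> l \<in> shear n'"
    by blast
  have "\<alpha> l \<in> shear n \<longleftrightarrow> l \<in> M" for l
    using shift[OF subspace_0[OF lie_idealD(1)[OF ideal_A]], of l] by (simp add: shear_0)
  then have K': "K = shear n"
    unfolding K using bij_is_surj[OF \<alpha>] by (auto simp: image_iff) (metis surjD)
  moreover have "m - bracket m n \<in> M \<longleftrightarrow> bracket m n \<in> M" if "m \<in> M" for m
    using subspace_diff[OF subspace_M that, of "m - bracket m n"]
      subspace_diff[OF subspace_M that, of "bracket m n"] by auto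
  then have "M \<inter> shear n = {m \<in> M. bracket m n \<in> M}" by (auto simp: shear_def)
  ultimately show ?thesis
    using n defined exp_ad_image[OF defined n(1)] by (intro bexI[of _ n]) auto
qed

end

section \<open>Conjugacy in solvable Lie algebras\<close>

theorem theorem0p5:
  fixes scale :: "'f::field \<Rightarrow> 'a::ab_group_add \<Rightarrow> 'a"
    and bracket :: "'a \<Rightarrow> 'a \<Rightarrow> 'a"
    and A B M K :: "'a set"
  assumes "lie_algebra scale bracket"
    and "\<exists>Basis. finite_dimensional_vector_space scale Basis"
    and "lie_algebra.solvable scale bracket"
    and "CHAR('f) > 0 \<Longrightarrow>
      lie_algebra.nilpotent scale bracket (lie_algebra.lie_prod scale bracket UNIV UNIV) \<and>
      lie_algebra.nilpotency_class scale bracket (lie_algebra.lie_prod scale bracket UNIV UNIV)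
        < CHAR('f)"
    and "lie_algebra.chief_factor scale bracket A B"
    and "lie_algebra.maximal_subalgebra scale bracket M"
    and "lie_algebra.complements M A B"
    and "lie_algebra.conjugate scale bracket K M"
  shows "\<exists>a\<in>A. lie_algebra.exp_ad_defined scale bracket a \<and>
    K = lie_algebra.exp_ad scale bracket a ` M \<and>
    M \<inter> K = {m \<in> M. bracket m a \<in> M}"
proof -
  interpret lie_algebra scale bracket by (rule assms(1))
  obtain Basis where "finite_dimensional_vector_space scale Basis" using assms(2) by blast
  then interpret finite_dimensional_vector_space scale Basis .
  interpret fd_lie_algebra scale bracket Basis ..
  let ?L2 = "lie_prod UNIV UNIV"
  have L2: "lie_ideal ?L2" by (rule lie_ideal_lie_prod[OF lie_ideal_UNIV lie_ideal_UNIV])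
  have trivial: "?L2 \<subseteq> factor_centralizer A' B'" if "chief_factor A' B'" for A' B'
  proof (rule derived_algebra_acts_trivially[OF assms(3) that])
    assume "CHAR('f) \<noteq> 0"
    then show "\<forall>z\<in>?L2. \<exists>N. \<forall>v. (ad z ^^ N) v = 0"
      using ad_pow_class_zero[OF L2] assms(4) by blast
  qed
  interpret complemented_chief_factor scale bracket A B M
    by unfold_locales (use assms(5-7) trivial in \<open>auto simp: complements_def\<close>)
  show ?thesis
  proof (rule conjugate_is_exp_image[OF _ _ assms(8)])
    fix x assume "exp_ad_defined x"
    then obtain n where "\<And>v. (ad x ^^ n) v = 0" using exp_ad_expansion by blast
    then show "x \<in> factor_centralizer A B"
      by (rule nilpotent_acts_trivially[OF chief derived_trivial])
  next
    fix a assume a: "a \<in> ?L2"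
    show "exp_ad_defined a"
    proof (cases "CHAR('f) = 0")
      case True
      then show ?thesis
        using derived_algebra_ad_nilpotent[OF trivial a] by (simp add: exp_ad_defined_def)
    next
      case False
      then show ?thesis using assms(4) L2 a by (auto simp: exp_ad_defined_def)
    qed
  qed
qed

end
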